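(* Let $p,q\ge 3$ be relatively prime odd integers, let $k_p,k_q$ be integers with $\gcd(k_p,p)=1$ and $\gcd(k_q,q)=1$, and let $c$ be a non-zero real number such that \[ c^2=-\frac{\cos\left(2\pi\left(\frac{k_p}{p}-\frac{k_q}{q}\right)\right)}{\cos\left(2\pi\left(\frac{k_p}{p}+\frac{k_q}{q}\right)\right)}. \] Let $a,b\in\mathbb{R}^4$ be \[ a=\begin{pmatrix}(1-c)\cos\frac{2\pi k_q}{q}\\ (1-c)\sin\frac{2\pi k_q}{q}\\ -(1+c)\sin\frac{2\pi k_q}{q}\\ (1-c)\cos\frac{2\pi k_q}{q}\end{pmatrix},\qquad b=\begin{pmatrix}c+1\\0\\0\\c-1\end{pmatrix}. \] Let $r$ be the unique integer in the interval $(0,pq)$ with $r\equiv 1\pmod p$ and $r\equiv -1\pmod q$, and let $M=R_{p,k_p}\otimes R_{q,k_q}$. Then: (i) For $0\le i<pq$ the set $B_i=\{M^ia,\ M^{i-1}a,\ M^ib,\ M^{i-r}b\}$ is an orthogonal basis of $\mathbb{R}^4$. (ii) Let $\mathcal{V}=\{M^ia: 0\le i<pq\}\cup\{M^ib:0\le i<pq\}$ and $\mathcal{B}=\{B_i:0\le i<pq\}$. Then $(\mathcal{V},\mathcal{B})$ is a Kochen-Specker pair in $\mathbb{R}^4$.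
   Context: For integers $m>0$ and $s\ge 0$, $R_{m,s}$ denotes the $2\times 2$ rotation matrix $\begin{pmatrix}\cos(2\pi s/m) & -\sin(2\pi s/m)\\ \sin(2\pi s/m) & \cos(2\pi s/m)\end{pmatrix}$. $\otimes$ denotes the Kronecker product of matrices. A pair $(\mathcal{V},\mathcal{B})$ is a Kochen-Specker pair in $\mathbb{C}^n$ (here applied with real vectors, $n=4$) if: (1) $\mathcal{V}$ is a finite set of vectors in $\mathbb{C}^n$; (2) $\mathcal{B}=(B_1,\dots,B_k)$ with $k$ odd, where each $B_i$ is an orthogonal basis of $\mathbb{C}^n$ with $B_i\subset\mathcal{V}$; (3) for each $v\in\mathcal{V}$, the number of indices $i$ with $v\in B_i$ is even.
   Formalization: The fourth entry of a is taken to be (1+c)cos(2πk_q/q) instead of the printed (1−c)cos(2πk_q/q); with the printed entry a is never orthogonal to Ma, so (i) fails for all admissible parameters. *)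

theory Defs
  imports
    "HOL-Number_Theory.Cong"
    "HOL-Analysis.Complex_Transcendental"
    "Jordan_Normal_Form.VS_Connect"
begin

definition rotation_mat :: "int \<Rightarrow> int \<Rightarrow> real mat" where
  "rotation_mat m s = mat_of_rows_list 2
     [[cos (2 * pi * of_int s / of_int m), - sin (2 * pi * of_int s / of_int m)],
      [sin (2 * pi * of_int s / of_int m),   cos (2 * pi * of_int s / of_int m)]]"

definition kronecker_product :: "'a::times mat \<Rightarrow> 'a mat \<Rightarrow> 'a mat" where
  "kronecker_product A B = mat (dim_row A * dim_row B) (dim_col A * dim_col B)
     (\<lambda>(i, j). A $$ (i div dim_row B, j div dim_col B) * B $$ (i mod dim_row B, j mod dim_col B))"

text \<open>Powers with possibly negative exponent, in the monoid of \<open>n \<times> n\<close> matrices;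
  meaningful for negative exponents only if \<open>A\<close> is invertible.\<close>

abbreviation mat_int_pow :: "nat \<Rightarrow> 'a::semiring_1 mat \<Rightarrow> int \<Rightarrow> 'a mat" where
  "mat_int_pow n A z \<equiv> A [^]\<^bsub>ring_mat TYPE('a) n ()\<^esub> z"

text \<open>The scalar product \<open>\<bullet>c\<close> conjugates its second argument. So the following notions are
  the Hermitian ones in \<open>\<complex>\<^sup>n\<close> for \<open>'a = complex\<close> and the Euclidean ones in \<open>\<real>\<^sup>n\<close> for
  \<open>'a = real\<close>.\<close>

definition orthogonal_basis :: "nat \<Rightarrow> 'a::conjugatable_field vec set \<Rightarrow> bool" where
  "orthogonal_basis n B \<longleftrightarrow>
     vectorspace.basis class_ring (module_vec TYPE('a) n) B \<and>
     (\<forall>u\<in>B. \<forall>v\<in>B. u \<noteq> v \<longrightarrow> u \<bullet>c v = 0)"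

definition kochen_specker_pair ::
    "nat \<Rightarrow> 'a::conjugatable_field vec set \<Rightarrow> 'a vec set list \<Rightarrow> bool" where
  "kochen_specker_pair n V Bs \<longleftrightarrow>
     finite V \<and> V \<subseteq> carrier_vec n \<and>
     odd (length Bs) \<and> (\<forall>B\<in>set Bs. orthogonal_basis n B \<and> B \<subseteq> V) \<and>
     (\<forall>v\<in>V. even (card {i. i < length Bs \<and> v \<in> Bs ! i}))"

text \<open>The last entry is \<open>(1 + c) cos \<phi>\<close>. The printed source has \<open>(1 - c) cos \<phi>\<close>, a sign error:
  with \<open>\<theta> = 2 \<pi> k\<^sub>p / p\<close>, \<open>\<phi> = 2 \<pi> k\<^sub>q / q\<close> and the required value of \<open>c\<^sup>2\<close>, that vector
  has scalar product \<open>2 (1 - c)\<^sup>2 (cos \<phi>)\<^sup>2 cos (\<theta> - \<phi>) \<noteq> 0\<close> with its image under \<open>M\<close>.\<close>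

definition vec_a :: "real \<Rightarrow> real \<Rightarrow> real vec" where
  "vec_a c \<phi> = vec_of_list
     [(1 - c) * cos \<phi>, (1 - c) * sin \<phi>, - (1 + c) * sin \<phi>, (1 + c) * cos \<phi>]"

definition vec_b :: "real \<Rightarrow> real vec" where
  "vec_b c = vec_of_list [c + 1, 0, 0, c - 1]"

end

theory Submission
  imports
    Defs
    "HOL-Library.Real_Mod"
    "Jordan_Normal_Form.Gram_Schmidt"
begin

unbundle no vec_syntax

text \<open>A vector of \<open>\<real>\<^sup>4\<close>, read row by row as a \<open>2 \<times> 2\<close> matrix, is an \<open>\<real>\<close>-linear map
  \<open>z \<mapsto> \<alpha> z + \<beta> cnj z\<close> of \<open>\<complex>\<close>. In the coordinates \<open>(\<alpha>, \<beta>) \<in> \<complex>\<^sup>2\<close> the Kronecker product of the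
  rotations by \<open>\<theta>\<close> and \<open>\<phi>\<close> is diagonal with entries \<open>cis (\<theta> - \<phi>)\<close> and \<open>cis (\<theta> + \<phi>)\<close>, while
  \<open>a = (cis (- \<phi>), - c cis \<phi>)\<close> and \<open>b = (c, 1)\<close>. With \<open>\<theta>\<close>, \<open>\<phi>\<close> of coprime odd orders \<open>p\<close>, \<open>q\<close>
  modulo \<open>2 \<pi>\<close>, all scalar products in \<open>B\<^sub>i\<close> become cosine identities: the mixed ones vanish by
  the congruences defining \<open>r\<close>, the other two by the choice of \<open>c\<close>. Both orbits have exactly \<open>p q\<close>
  elements and they are disjoint because \<open>p q\<close> is odd, so every vector lies in exactly two of
  the \<open>B\<^sub>i\<close>.\<close>

section \<open>Orthogonal bases\<close>

lemma corthogonal_imp_lin_indpt: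
  fixes us :: "'a::conjugatable_field vec list"
  assumes carrier: "set us \<subseteq> carrier_vec n" and orth: "corthogonal us"
  shows "\<not> module.lin_dep class_ring (module_vec TYPE('a) n) (set us)"
proof -
  interpret vec_space "TYPE('a)" n .
  show ?thesis
  proof (rule finite_lin_indpt2)
    fix f :: "'a vec \<Rightarrow> 'a"
    assume zero: "lincomb f (set us) = 0\<^sub>v n"
    show "\<forall>v\<in>set us. f v = 0"
    proof
      fix v assume v: "v \<in> set us"
      have conj_v: "conjugate v \<in> carrier_vec n"
        using v carrier by auto
      have orth_v: "u \<bullet>c v = 0 \<longleftrightarrow> u \<noteq> v" if "u \<in> set us" for u
        using that v corthogonalD[OF orth] corthogonal_distinct[OF orth]
        by (metis in_set_conv_nth nth_eq_iff_index_eq)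
      have "0 = lincomb f (set us) \<bullet>c v"
        using zero conj_v by simp
      also have "\<dots> = (\<Sum>u\<in>set us. (f u \<cdot>\<^sub>v u) \<bullet>c v)"
        unfolding lincomb_def using carrier conj_v by (intro finsum_scalar_prod_sum) auto
      also have "\<dots> = (\<Sum>u\<in>set us. if u = v then f v * (v \<bullet>c v) else 0)"
        using carrier orth_v
        by (intro sum.cong refl) (auto simp: smult_scalar_prod_distrib[OF _ conj_v])
      also have "\<dots> = f v * (v \<bullet>c v)"
        using v by simp
      finally show "f v = 0"
        using orth_v[OF v] by simp
    qed
  qed (use carrier in auto)
qed

lemma corthogonal_imp_orthogonal_basis:
  fixes us :: "'a::conjugatable_field vec list"
  assumes "set us \<subseteq> carrier_vec n" "corthogonal us" "length us = n"
  shows "orthogonal_basis n (set us)"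
proof -
  interpret vec_space "TYPE('a)" n .
  have "basis (set us)"
    using assms corthogonal_imp_lin_indpt[OF assms(1,2)]
    by (intro dim_li_is_basis) (auto simp: dim_is_n distinct_card corthogonal_distinct)
  moreover have "u \<bullet>c v = 0" if "u \<in> set us" "v \<in> set us" "u \<noteq> v" for u v
    using that corthogonalD[OF assms(2)] by (metis in_set_conv_nth)
  ultimately show ?thesis
    unfolding orthogonal_basis_def by blast
qed

lemma orthogonal_basis_imp_carrier:
  assumes "orthogonal_basis n (S :: 'a::conjugatable_field vec set)"
  shows "S \<subseteq> carrier_vec n"
proof -
  interpret vec_space "TYPE('a)" n .
  show ?thesis
    using assms by (auto simp: orthogonal_basis_def basis_def)
qed

lemma cscalar_prod_eq_0_commute:
  fixes u v :: "'a::{conjugatable_ring, comm_ring} vec"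
  assumes "u \<in> carrier_vec n" "v \<in> carrier_vec n"
  shows "u \<bullet>c v = 0 \<longleftrightarrow> v \<bullet>c u = 0"
proof -
  have "conjugate (v \<bullet>c u) = u \<bullet>c v"
    using assms conjugate_sprod_vec[of v n "conjugate u"]
    by (simp add: conjugate_vec_sprod_comm)
  then show ?thesis
    by (metis conjugate_zero_iff)
qed

lemma sorted_wrt_imp_corthogonal:
  fixes us :: "'a::conjugatable_ordered_field vec list"
  assumes carrier: "set us \<subseteq> carrier_vec n" and nonzero: "0\<^sub>v n \<notin> set us"
    and orth: "sorted_wrt (\<lambda>u v. u \<bullet>c v = 0) us"
  shows "corthogonal us"
proof (rule corthogonalI)
  fix i j assume ij: "i < length us" "j < length us"
  then have in_carrier: "us ! i \<in> carrier_vec n" "us ! j \<in> carrier_vec n"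
    using carrier nth_mem by blast+
  consider "i < j" | "j < i" | "i = j"
    by linarith
  then show "us ! i \<bullet>c us ! j = 0 \<longleftrightarrow> i \<noteq> j"
  proof cases
    assume "i < j"
    then show ?thesis
      using orth ij by (simp add: sorted_wrt_iff_nth_less)
  next
    assume "j < i"
    then have "us ! j \<bullet>c us ! i = 0"
      using orth ij by (simp add: sorted_wrt_iff_nth_less)
    then show ?thesis
      using \<open>j < i\<close> cscalar_prod_eq_0_commute[OF in_carrier] by simp
  next
    assume "i = j"
    then show ?thesis
      using nonzero ij in_carrier nth_mem by fastforce
  qed
qed

section \<open>Residue systems\<close>

lemma binary_chinese_remainder_unique_pos_int:
  fixes p q u v :: int
  assumes "p > 0" "q > 0" "coprime p q" "\<not> p dvd u"
  shows "\<exists>!x. 0 < x \<and> x < p * q \<and> [x = u] (mod p) \<and> [x = v] (mod q)"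
proof -
  obtain x where x: "[x = u] (mod p)" "[x = v] (mod q)"
    using binary_chinese_remainder_int[OF assms(3)] by blast
  define y where "y = x mod (p * q)"
  have y: "[y = u] (mod p)" "[y = v] (mod q)"
    using x by (simp_all add: y_def cong_def mod_mod_cancel)
  have "y \<noteq> 0"
    using y(1) assms(4) by (auto simp: cong_def dvd_eq_mod_eq_0)
  moreover have "0 \<le> y" "y < p * q"
    using assms(1,2) by (simp_all add: y_def)
  moreover have "z = y" if "0 < z" "z < p * q" "[z = u] (mod p)" "[z = v] (mod q)" for z
  proof -
    have "[z = y] (mod p * q)"
      using that y assms(3) by (meson coprime_cong_mult cong_sym cong_trans)
    then show ?thesis
      using that \<open>0 \<le> y\<close> \<open>y < p * q\<close> by (simp add: cong_def)
  qed
  ultimately show ?thesis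
    using y by (intro ex1I[of _ y]) auto
qed

lemma residues_cong_pair:
  fixes n j k :: int
  assumes "n > 0"
  shows "{i \<in> {0..<n}. [i = j] (mod n) \<or> [i = k] (mod n)} = {j mod n, k mod n}"
  using assms by (auto simp: cong_def)

lemma card_nth_map_upto:
  "card {i. i < length (map f [0..n - 1]) \<and> P (map f [0..n - 1] ! i)} = card {i \<in> {0..<n}. P (f i)}"
proof -
  have "int ` {i. i < nat n \<and> P (f (int i))} = {i \<in> {0..<n}. P (f i)}"
    by (force simp: image_iff intro: exI[of _ "nat _"])
  then show ?thesis
    using card_image[of int "{i. i < nat n \<and> P (f (int i))}"] by (auto cong: conj_cong)
qed

section \<open>Kochen-Specker pairs from cyclic orbits\<close>

lemma kochen_specker_pair_cyclic_orbits:
  fixes K :: "'k set" and X :: "'k \<Rightarrow> int \<Rightarrow> 'a::conjugatable_field vec" and s :: "'k \<Rightarrow> int"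
  defines "B \<equiv> \<lambda>i. \<Union>k\<in>K. {X k i, X k (i - s k)}"
  assumes "finite K" and n: "n > 0" "odd n"
    and X_eq_iff: "\<And>k l i j. k \<in> K \<Longrightarrow> l \<in> K \<Longrightarrow> X k i = X l j \<longleftrightarrow> k = l \<and> [i = j] (mod n)"
    and shift: "\<And>k. k \<in> K \<Longrightarrow> \<not> n dvd s k"
    and basis: "\<And>i. orthogonal_basis d (B i)"
  shows "kochen_specker_pair d (\<Union>k\<in>K. X k ` {0..<n}) (map B [0..n - 1])"
proof -
  define V where "V = (\<Union>k\<in>K. X k ` {0..<n})"
  have X_in_V: "X k i \<in> V" if "k \<in> K" for k i
  proof -
    have "X k i = X k (i mod n)"
      using X_eq_iff[OF that that] by (simp add: cong_def)
    then show ?thesis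
      using that n unfolding V_def by (intro UN_I[of k]) auto
  qed
  have "V \<subseteq> (\<Union>i. B i)"
    by (auto simp: V_def B_def)
  then have "V \<subseteq> carrier_vec d"
    using basis[THEN orthogonal_basis_imp_carrier] by blast
  moreover have "finite V"
    using \<open>finite K\<close> by (simp add: V_def)
  moreover have "odd (length (map B [0..n - 1]))"
    using n by (simp add: even_nat_iff)
  moreover have "B i \<subseteq> V" for i
    using X_in_V by (auto simp: B_def)
  moreover have "card {i. i < length (map B [0..n - 1]) \<and> v \<in> map B [0..n - 1] ! i} = 2"
    if "v \<in> V" for v
  proof -
    obtain k j where k: "k \<in> K" and v: "v = X k j"
      using \<open>v \<in> V\<close> by (auto simp: V_def)
    have "v \<in> B i \<longleftrightarrow> [i = j] (mod n) \<or> [i = j + s k] (mod n)" for i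
    proof -
      have "v \<in> B i \<longleftrightarrow> [j = i] (mod n) \<or> [j = i - s k] (mod n)"
        using k X_eq_iff by (auto simp: B_def v)
      then show ?thesis
        by (simp add: cong_iff_dvd_diff dvd_diff_commute[of n j] diff_diff_eq add.commute)
    qed
    then have "{i \<in> {0..<n}. v \<in> B i} = {j mod n, (j + s k) mod n}"
      using residues_cong_pair[OF n(1)] by simp
    moreover have "j mod n \<noteq> (j + s k) mod n"
      using shift[OF k] by (simp add: mod_eq_dvd_iff)
    ultimately show ?thesis
      unfolding card_nth_map_upto by simp
  qed
  ultimately show ?thesis
    unfolding kochen_specker_pair_def V_def[symmetric] using basis by auto
qed

section \<open>Kronecker products of plane rotations\<close>

lemma sum_div_mod:
  fixes f :: "nat \<Rightarrow> nat \<Rightarrow> 'a::comm_monoid_add"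
  shows "(\<Sum>k<m * n. f (k div n) (k mod n)) = (\<Sum>i<m. \<Sum>j<n. f i j)"
proof -
  have "(\<Sum>k = i * n..<i * n + n. f (k div n) (k mod n)) = (\<Sum>j<n. f i j)" for i
    using sum.shift_bounds_nat_ivl[of "\<lambda>k. f (k div n) (k mod n)" 0 "i * n" n]
    by (simp add: atLeast0LessThan add.commute)
  then show ?thesis
    by (simp flip: sum.nat_group)
qed

lemma kronecker_product_dims [simp]:
  "dim_row (kronecker_product A B) = dim_row A * dim_row B"
  "dim_col (kronecker_product A B) = dim_col A * dim_col B"
  by (simp_all add: kronecker_product_def)

lemma kronecker_product_index:
  assumes "i < dim_row A * dim_row B" "j < dim_col A * dim_col B"
  shows "kronecker_product A B $$ (i, j) =
    A $$ (i div dim_row B, j div dim_col B) * B $$ (i mod dim_row B, j mod dim_col B)"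
  using assms by (simp add: kronecker_product_def)

lemma kronecker_product_one:
  "kronecker_product (1\<^sub>m m) (1\<^sub>m n) = (1\<^sub>m (m * n) :: 'a::semiring_1 mat)"
proof (rule eq_matI)
  fix i j
  assume "i < dim_row (1\<^sub>m (m * n) :: 'a mat)" "j < dim_col (1\<^sub>m (m * n) :: 'a mat)"
  then have "i < m * n" "j < m * n"
    by simp_all
  moreover from this have "n > 0"
    by (cases n) auto
  moreover have "i = j \<longleftrightarrow> i div n = j div n \<and> i mod n = j mod n"
    by (metis div_mult_mod_eq)
  ultimately show "kronecker_product (1\<^sub>m m) (1\<^sub>m n) $$ (i, j) = (1\<^sub>m (m * n) :: 'a mat) $$ (i, j)"
    by (auto simp: kronecker_product_index less_mult_imp_div_less)
qed simp_all

lemma kronecker_product_mult: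
  fixes A B C D :: "'a::comm_semiring_0 mat"
  assumes "dim_col A = dim_row C" "dim_col B = dim_row D"
  shows "kronecker_product A B * kronecker_product C D = kronecker_product (A * C) (B * D)"
proof (rule eq_matI)
  fix i j
  assume "i < dim_row (kronecker_product (A * C) (B * D))"
    "j < dim_col (kronecker_product (A * C) (B * D))"
  then have ij: "i < dim_row A * dim_row B" "j < dim_col C * dim_col D"
    by simp_all
  then have "dim_row B > 0" "dim_col D > 0"
    by (auto intro: Nat.gr0I)
  define i' i'' j' j'' where "i' = i div dim_row B" and "i'' = i mod dim_row B"
    and "j' = j div dim_col D" and "j'' = j mod dim_col D"
  have index_less: "i' < dim_row A" "i'' < dim_row B" "j' < dim_col C" "j'' < dim_col D"
    using ij \<open>dim_row B > 0\<close> \<open>dim_col D > 0\<close>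
    by (simp_all add: i'_def i''_def j'_def j''_def less_mult_imp_div_less)
  have "(kronecker_product A B * kronecker_product C D) $$ (i, j) =
      (\<Sum>k<dim_row C * dim_row D. A $$ (i', k div dim_row D) * B $$ (i'', k mod dim_row D) *
         (C $$ (k div dim_row D, j') * D $$ (k mod dim_row D, j'')))"
    using ij assms
    by (simp add: scalar_prod_def kronecker_product_index atLeast0LessThan
        i'_def i''_def j'_def j''_def)
  also have "\<dots> = (\<Sum>k<dim_row C. \<Sum>l<dim_row D. A $$ (i', k) * B $$ (i'', l) *
      (C $$ (k, j') * D $$ (l, j'')))"
    by (rule sum_div_mod)
  also have "\<dots> = (\<Sum>k<dim_row C. A $$ (i', k) * C $$ (k, j')) *
      (\<Sum>l<dim_row D. B $$ (i'', l) * D $$ (l, j''))"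
    by (simp add: sum_product ac_simps)
  also have "\<dots> = kronecker_product (A * C) (B * D) $$ (i, j)"
    using ij index_less assms
    by (simp add: kronecker_product_index scalar_prod_def atLeast0LessThan
        i'_def i''_def j'_def j''_def)
  finally show "(kronecker_product A B * kronecker_product C D) $$ (i, j) =
      kronecker_product (A * C) (B * D) $$ (i, j)" .
qed simp_all

definition plane_rotation :: "real \<Rightarrow> real mat" where
  "plane_rotation \<theta> = mat_of_rows_list 2 [[cos \<theta>, - sin \<theta>], [sin \<theta>, cos \<theta>]]"

lemma plane_rotation_dims [simp]:
  "dim_row (plane_rotation \<theta>) = 2" "dim_col (plane_rotation \<theta>) = 2"
  by (simp_all add: plane_rotation_def mat_of_rows_list_def)

lemma plane_rotation_index:
  "plane_rotation \<theta> $$ (0, 0) = cos \<theta>" "plane_rotation \<theta> $$ (0, Suc 0) = - sin \<theta>"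
  "plane_rotation \<theta> $$ (Suc 0, 0) = sin \<theta>" "plane_rotation \<theta> $$ (Suc 0, Suc 0) = cos \<theta>"
  by (simp_all add: plane_rotation_def mat_of_rows_list_def)

lemma plane_rotation_0: "plane_rotation 0 = 1\<^sub>m 2"
  by (rule eq_matI) (auto simp: less_2_cases_iff plane_rotation_index)

lemma plane_rotation_mult: "plane_rotation s * plane_rotation t = plane_rotation (s + t)"
  by (rule eq_matI)
    (auto simp: less_Suc_eq scalar_prod_def numeral_2_eq_2
      plane_rotation_index cos_add sin_add)

definition rotation_kron :: "real \<Rightarrow> real \<Rightarrow> real mat" where
  "rotation_kron \<theta> \<phi> = kronecker_product (plane_rotation \<theta>) (plane_rotation \<phi>)"

lemma rotation_kron_dims [simp]:
  "dim_row (rotation_kron \<theta> \<phi>) = 4" "dim_col (rotation_kron \<theta> \<phi>) = 4"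
  by (simp_all add: rotation_kron_def)

lemma rotation_kron_carrier [simp]: "rotation_kron \<theta> \<phi> \<in> carrier_mat 4 4"
  by (rule carrier_matI) simp_all

lemma rotation_kron_0: "rotation_kron 0 0 = 1\<^sub>m 4"
  by (simp add: rotation_kron_def plane_rotation_0 kronecker_product_one)

lemma rotation_kron_mult:
  "rotation_kron s t * rotation_kron s' t' = rotation_kron (s + s') (t + t')"
  by (simp add: rotation_kron_def kronecker_product_mult plane_rotation_mult)

lemma rotation_kron_int_pow:
  "mat_int_pow 4 (rotation_kron \<theta> \<phi>) i = rotation_kron (of_int i * \<theta>) (of_int i * \<phi>)"
proof -
  interpret ring "ring_mat TYPE(real) 4 ()"
    by (rule ring_mat)
  have "rotation_kron \<theta> \<phi> [^]\<^bsub>ring_mat TYPE(real) 4 ()\<^esub> k =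
      rotation_kron (of_nat k * \<theta>) (of_nat k * \<phi>)" for k :: nat
    by (induction k) (auto simp: ring_mat_simps rotation_kron_0 rotation_kron_mult algebra_simps)
  moreover have "inv\<^bsub>ring_mat TYPE(real) 4 ()\<^esub> (rotation_kron s t) = rotation_kron (- s) (- t)" for s t
    by (rule inv_char) (simp_all add: ring_mat_simps rotation_kron_mult rotation_kron_0)
  ultimately show ?thesis
    by (auto simp: int_pow_def2)
qed

section \<open>Diagonalizing coordinates\<close>

definition vec_of_complex_pair :: "complex \<Rightarrow> complex \<Rightarrow> real vec" where
  "vec_of_complex_pair \<alpha> \<beta> = vec_of_list
     [Re \<alpha> + Re \<beta>, Im \<beta> - Im \<alpha>, Im \<alpha> + Im \<beta>, Re \<alpha> - Re \<beta>]"

lemma vec_of_complex_pair_carrier [simp]: "vec_of_complex_pair \<alpha> \<beta> \<in> carrier_vec 4"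
  unfolding vec_of_complex_pair_def by (rule carrier_vecI) simp

lemma vec_of_complex_pair_dim [simp]: "dim_vec (vec_of_complex_pair \<alpha> \<beta>) = 4"
  using vec_of_complex_pair_carrier by (rule carrier_vecD)

lemma vec_of_complex_pair_index:
  "vec_of_complex_pair \<alpha> \<beta> $ 0 = Re \<alpha> + Re \<beta>"
  "vec_of_complex_pair \<alpha> \<beta> $ Suc 0 = Im \<beta> - Im \<alpha>"
  "vec_of_complex_pair \<alpha> \<beta> $ 2 = Im \<alpha> + Im \<beta>"
  "vec_of_complex_pair \<alpha> \<beta> $ 3 = Re \<alpha> - Re \<beta>"
  by (simp_all add: vec_of_complex_pair_def vec_of_list_index eval_nat_numeral)

lemma vec_of_complex_pair_eq_iff:
  "vec_of_complex_pair \<alpha> \<beta> = vec_of_complex_pair \<alpha>' \<beta>' \<longleftrightarrow> \<alpha> = \<alpha>' \<and> \<beta> = \<beta>'"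
proof
  assume "vec_of_complex_pair \<alpha> \<beta> = vec_of_complex_pair \<alpha>' \<beta>'"
  then have "vec_of_complex_pair \<alpha> \<beta> $ i = vec_of_complex_pair \<alpha>' \<beta>' $ i" for i
    by simp
  from this[of 0] this[of "Suc 0"] this[of 2] this[of 3] show "\<alpha> = \<alpha>' \<and> \<beta> = \<beta>'"
    unfolding vec_of_complex_pair_index complex_eq_iff by linarith
qed simp

lemma sum_lessThan_4: "(\<Sum>i<4. f i) = f 0 + f 1 + f 2 + f (3::nat)"
  by (simp add: eval_nat_numeral)

lemma vec_of_complex_pair_cscalar_prod:
  "vec_of_complex_pair \<alpha> \<beta> \<bullet>c vec_of_complex_pair \<alpha>' \<beta>' = 2 * Re (\<alpha> * cnj \<alpha>' + \<beta> * cnj \<beta>')"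
  by (simp add: scalar_prod_def atLeast0LessThan sum_lessThan_4 vec_of_complex_pair_index
      algebra_simps)

lemma rotation_kron_mult_vec_of_complex_pair:
  "rotation_kron \<theta> \<phi> *\<^sub>v vec_of_complex_pair \<alpha> \<beta> =
   vec_of_complex_pair (cis (\<theta> - \<phi>) * \<alpha>) (cis (\<theta> + \<phi>) * \<beta>)"
proof (rule eq_vecI)
  fix i
  assume "i < dim_vec (vec_of_complex_pair (cis (\<theta> - \<phi>) * \<alpha>) (cis (\<theta> + \<phi>) * \<beta>))"
  then have i: "i < 4"
    by simp
  then have i_cases: "i = 0 \<or> i = 1 \<or> i = 2 \<or> i = 3"
    by auto
  have "(rotation_kron \<theta> \<phi> *\<^sub>v vec_of_complex_pair \<alpha> \<beta>) $ i =
      (\<Sum>k<4. rotation_kron \<theta> \<phi> $$ (i, k) * vec_of_complex_pair \<alpha> \<beta> $ k)"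
    using i by (simp add: scalar_prod_def atLeast0LessThan)
  also have "\<dots> = vec_of_complex_pair (cis (\<theta> - \<phi>) * \<alpha>) (cis (\<theta> + \<phi>) * \<beta>) $ i"
    using i_cases unfolding sum_lessThan_4
    by (elim disjE)
      (simp_all add: rotation_kron_def kronecker_product_index plane_rotation_index
        vec_of_complex_pair_index cos_add sin_add cos_diff sin_diff algebra_simps)
  finally show "(rotation_kron \<theta> \<phi> *\<^sub>v vec_of_complex_pair \<alpha> \<beta>) $ i =
      vec_of_complex_pair (cis (\<theta> - \<phi>) * \<alpha>) (cis (\<theta> + \<phi>) * \<beta>) $ i" .
qed simp

definition rotation_orbit :: "real \<Rightarrow> real \<Rightarrow> real vec \<Rightarrow> int \<Rightarrow> real vec" where
  "rotation_orbit \<theta> \<phi> v i = mat_int_pow 4 (rotation_kron \<theta> \<phi>) i *\<^sub>v v"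

lemma rotation_orbit_of_complex_pair:
  "rotation_orbit \<theta> \<phi> (vec_of_complex_pair \<alpha> \<beta>) i =
   vec_of_complex_pair (cis (of_int i * (\<theta> - \<phi>)) * \<alpha>) (cis (of_int i * (\<theta> + \<phi>)) * \<beta>)"
  by (simp add: rotation_orbit_def rotation_kron_int_pow rotation_kron_mult_vec_of_complex_pair
      right_diff_distrib distrib_left)

lemma rotation_orbit_cscalar_prod:
  "rotation_orbit \<theta> \<phi> (vec_of_complex_pair \<alpha> \<beta>) i \<bullet>c
   rotation_orbit \<theta> \<phi> (vec_of_complex_pair \<alpha>' \<beta>') j =
   2 * Re (cis (of_int (i - j) * (\<theta> - \<phi>)) * (\<alpha> * cnj \<alpha>') +
           cis (of_int (i - j) * (\<theta> + \<phi>)) * (\<beta> * cnj \<beta>'))"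
proof -
  have "cis (of_int (i - j) * t) = cis (of_int i * t) * cnj (cis (of_int j * t))" for t
    by (simp add: cis_cnj cis_mult left_diff_distrib)
  then show ?thesis
    unfolding rotation_orbit_of_complex_pair vec_of_complex_pair_cscalar_prod
    by (simp only: complex_cnj_mult ac_simps)
qed

section \<open>Orbits under rotations of coprime odd orders\<close>

definition has_angle_order :: "real \<Rightarrow> int \<Rightarrow> bool" where
  "has_angle_order \<theta> m \<longleftrightarrow> (\<forall>d::int. cis (of_int d * \<theta>) = 1 \<longleftrightarrow> m dvd d)"

lemma has_angle_order_2pi_frac:
  fixes k m :: int
  assumes "m > 0" "coprime k m"
  shows "has_angle_order (2 * pi * of_int k / of_int m) m"
  unfolding has_angle_order_def
proof
  fix d :: int
  have "of_int d * (2 * pi * of_int k / of_int m) = of_int l * (2 * pi) \<longleftrightarrow> d * k = l * m"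
    for l :: int
  proof -
    have "of_int d * (2 * pi * of_int k / of_int m) = of_int l * (2 * pi) \<longleftrightarrow>
        real_of_int (d * k) = of_int (l * m)"
      using \<open>m > 0\<close> by (simp add: field_simps)
    then show ?thesis
      by (simp only: of_int_eq_iff)
  qed
  then have "cis (of_int d * (2 * pi * of_int k / of_int m)) = 1 \<longleftrightarrow> m dvd d * k"
    by (auto simp: cis_eq_1_iff dvd_def mult.commute[of m])
  then show "cis (of_int d * (2 * pi * of_int k / of_int m)) = 1 \<longleftrightarrow> m dvd d"
    using \<open>coprime k m\<close> by (simp add: coprime_commute coprime_dvd_mult_left_iff)
qed

lemma cis_of_int_mult_eq_iff:
  fixes i j :: int
  shows "cis (of_int i * t) = cis (of_int j * t) \<longleftrightarrow> cis (of_int (i - j) * t) = 1"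
  by (simp add: left_diff_distrib flip: cis_divide)

lemma has_angle_order_cis_eq_iff:
  fixes i j :: int
  assumes "has_angle_order \<theta> m"
  shows "cis (of_int i * \<theta>) = cis (of_int j * \<theta>) \<longleftrightarrow> [i = j] (mod m)"
  using assms unfolding cis_of_int_mult_eq_iff has_angle_order_def cong_iff_dvd_diff by blast

lemma cis_of_int_mult_power:
  fixes n k :: int
  assumes "n \<ge> 0"
  shows "cis (of_int k * t) ^ nat n = cis (of_int (n * k) * t)"
  using assms by (simp add: Complex.DeMoivre ac_simps)

lemma has_angle_order_sin_eq_0:
  assumes "has_angle_order \<theta> m" "m dvd d"
  shows "sin (of_int d * \<theta>) = 0"
  using assms by (metis has_angle_order_def cis.sel(2) one_complex.sel(2))

context
  fixes p q :: int and \<theta> \<phi> :: real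
  assumes order: "has_angle_order \<theta> p" "has_angle_order \<phi> q"
    and pq: "odd p" "odd q" "coprime p q"
begin

lemma cis_diff_sum_eq_1_iff:
  "cis (of_int d * (\<theta> - \<phi>)) = 1 \<and> cis (of_int d * (\<theta> + \<phi>)) = 1 \<longleftrightarrow> p * q dvd d"
proof
  assume eq_1: "cis (of_int d * (\<theta> - \<phi>)) = 1 \<and> cis (of_int d * (\<theta> + \<phi>)) = 1"
  have "cis (of_int (2 * d) * \<theta>) = cis (of_int d * (\<theta> + \<phi>)) * cis (of_int d * (\<theta> - \<phi>))"
    "cis (of_int (2 * d) * \<phi>) = cis (of_int d * (\<theta> + \<phi>)) / cis (of_int d * (\<theta> - \<phi>))"
    by (simp_all add: cis_mult cis_divide algebra_simps)
  then have "p dvd 2 * d" "q dvd 2 * d"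
    using order eq_1 by (simp_all add: has_angle_order_def del: of_int_mult)
  then show "p * q dvd d"
    using pq by (simp add: coprime_dvd_mult_right_iff divides_mult)
next
  assume "p * q dvd d"
  then have "cis (of_int d * \<theta>) = 1" "cis (of_int d * \<phi>) = 1"
    using order unfolding has_angle_order_def by (meson dvd_mult_left dvd_mult_right)+
  then show "cis (of_int d * (\<theta> - \<phi>)) = 1 \<and> cis (of_int d * (\<theta> + \<phi>)) = 1"
    by (simp add: right_diff_distrib distrib_left flip: cis_divide cis_mult)
qed

lemma rotation_orbit_eq_iff:
  assumes "\<alpha> \<noteq> 0" "\<beta> \<noteq> 0"
  shows "rotation_orbit \<theta> \<phi> (vec_of_complex_pair \<alpha> \<beta>) i =
    rotation_orbit \<theta> \<phi> (vec_of_complex_pair \<alpha> \<beta>) j \<longleftrightarrow> [i = j] (mod p * q)"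
  using assms cis_diff_sum_eq_1_iff[of "i - j"]
  by (simp add: rotation_orbit_of_complex_pair vec_of_complex_pair_eq_iff cong_iff_dvd_diff
      cis_of_int_mult_eq_iff)

lemma rotation_orbit_eq_imp_power_eq:
  assumes "p * q > 0"
    and "rotation_orbit \<theta> \<phi> (vec_of_complex_pair \<alpha> \<beta>) i =
      rotation_orbit \<theta> \<phi> (vec_of_complex_pair \<alpha>' \<beta>') j"
  shows "\<alpha> ^ nat (p * q) = \<alpha>' ^ nat (p * q)" "\<beta> ^ nat (p * q) = \<beta>' ^ nat (p * q)"
proof -
  have root: "cis (of_int k * (\<theta> - \<phi>)) ^ nat (p * q) = 1"
    "cis (of_int k * (\<theta> + \<phi>)) ^ nat (p * q) = 1" for k
    using cis_diff_sum_eq_1_iff[of "p * q * k"] \<open>p * q > 0\<close>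
    by (simp_all add: cis_of_int_mult_power del: of_int_mult)
  have "cis (of_int i * (\<theta> - \<phi>)) * \<alpha> = cis (of_int j * (\<theta> - \<phi>)) * \<alpha>'"
    "cis (of_int i * (\<theta> + \<phi>)) * \<beta> = cis (of_int j * (\<theta> + \<phi>)) * \<beta>'"
    using assms(2) by (simp_all add: rotation_orbit_of_complex_pair vec_of_complex_pair_eq_iff)
  then show "\<alpha> ^ nat (p * q) = \<alpha>' ^ nat (p * q)" "\<beta> ^ nat (p * q) = \<beta>' ^ nat (p * q)"
    by (metis root mult_1 power_mult_distrib)+
qed

end

section \<open>The orbits of \<open>a\<close> and \<open>b\<close>\<close>

lemma vec_a_eq: "vec_a c \<phi> = vec_of_complex_pair (cis (- \<phi>)) (- of_real c * cis \<phi>)"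
  by (simp add: vec_a_def vec_of_complex_pair_def algebra_simps)

lemma vec_b_eq: "vec_b c = vec_of_complex_pair (of_real c) 1"
  by (simp add: vec_b_def vec_of_complex_pair_def)

lemma rotation_orbit_ab_carrier:
  "rotation_orbit \<theta> \<phi> (vec_a c \<phi>) i \<in> carrier_vec 4" "rotation_orbit \<theta> \<phi> (vec_b c) i \<in> carrier_vec 4"
  by (simp_all add: vec_a_eq vec_b_eq rotation_orbit_of_complex_pair)

lemma rotation_orbit_aa_cscalar_prod:
  "rotation_orbit \<theta> \<phi> (vec_a c \<phi>) i \<bullet>c rotation_orbit \<theta> \<phi> (vec_a c \<phi>) j =
   2 * (cos (of_int (i - j) * (\<theta> - \<phi>)) + c\<^sup>2 * cos (of_int (i - j) * (\<theta> + \<phi>)))"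
proof -
  have "cis (- \<phi>) * cnj (cis (- \<phi>)) = 1"
    "(- of_real c * cis \<phi>) * cnj (- of_real c * cis \<phi>) = of_real (c\<^sup>2)"
    by (simp_all add: cis_cnj cis_mult power2_eq_square)
  then show ?thesis
    unfolding vec_a_eq rotation_orbit_cscalar_prod by simp
qed

lemma rotation_orbit_bb_cscalar_prod:
  "rotation_orbit \<theta> \<phi> (vec_b c) i \<bullet>c rotation_orbit \<theta> \<phi> (vec_b c) j =
   2 * (c\<^sup>2 * cos (of_int (i - j) * (\<theta> - \<phi>)) + cos (of_int (i - j) * (\<theta> + \<phi>)))"
  unfolding vec_b_eq rotation_orbit_cscalar_prod by (simp add: power2_eq_square)

lemma rotation_orbit_ab_cscalar_prod:
  "rotation_orbit \<theta> \<phi> (vec_a c \<phi>) i \<bullet>c rotation_orbit \<theta> \<phi> (vec_b c) j =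
   4 * c * sin (of_int (i - j) * \<theta>) * sin (of_int (i - j + 1) * \<phi>)"
proof -
  define x y where "x = of_int (i - j) * \<theta>" and "y = of_int (i - j + 1) * \<phi>"
  have arg: "cis (of_int (i - j) * (\<theta> - \<phi>)) * cis (- \<phi>) = cis (x - y)"
    "cis (of_int (i - j) * (\<theta> + \<phi>)) * cis \<phi> = cis (x + y)"
    by (simp_all add: cis_mult x_def y_def algebra_simps)
  have "rotation_orbit \<theta> \<phi> (vec_a c \<phi>) i \<bullet>c rotation_orbit \<theta> \<phi> (vec_b c) j =
      2 * Re (of_real c * (cis (of_int (i - j) * (\<theta> - \<phi>)) * cis (- \<phi>)) -
              of_real c * (cis (of_int (i - j) * (\<theta> + \<phi>)) * cis \<phi>))"
    unfolding vec_a_eq vec_b_eq rotation_orbit_cscalar_prod by (simp add: algebra_simps)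
  also have "\<dots> = 2 * Re (of_real c * cis (x - y) - of_real c * cis (x + y))"
    unfolding arg ..
  also have "\<dots> = 4 * c * sin x * sin y"
    by (simp add: cos_diff cos_add algebra_simps)
  finally show ?thesis
    unfolding x_def y_def .
qed

lemma rotation_orbit_ab_nonzero:
  "rotation_orbit \<theta> \<phi> (vec_a c \<phi>) i \<noteq> 0\<^sub>v 4" "rotation_orbit \<theta> \<phi> (vec_b c) i \<noteq> 0\<^sub>v 4"
proof -
  have "1 + c\<^sup>2 \<noteq> 0"
    using zero_le_power2[of c] by linarith
  then show "rotation_orbit \<theta> \<phi> (vec_a c \<phi>) i \<noteq> 0\<^sub>v 4" "rotation_orbit \<theta> \<phi> (vec_b c) i \<noteq> 0\<^sub>v 4"
    using rotation_orbit_aa_cscalar_prod[of \<theta> \<phi> c i i] rotation_orbit_bb_cscalar_prod[of \<theta> \<phi> c i i]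
    by auto
qed

lemma rotation_orbit_ab_quadruple_orthogonal_basis:
  fixes p q r :: int
  assumes order: "has_angle_order \<theta> p" "has_angle_order \<phi> q"
    and c: "cos (\<theta> - \<phi>) + c\<^sup>2 * cos (\<theta> + \<phi>) = 0"
    and r: "[r = 1] (mod p)" "[r = - 1] (mod q)"
  shows "orthogonal_basis 4
    {rotation_orbit \<theta> \<phi> (vec_a c \<phi>) i, rotation_orbit \<theta> \<phi> (vec_a c \<phi>) (i - 1),
     rotation_orbit \<theta> \<phi> (vec_b c) i, rotation_orbit \<theta> \<phi> (vec_b c) (i - r)}"
proof -
  let ?X = "rotation_orbit \<theta> \<phi> (vec_a c \<phi>)" and ?Y = "rotation_orbit \<theta> \<phi> (vec_b c)"
  have aa: "?X i \<bullet>c ?X (i - 1) = 0"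
    unfolding rotation_orbit_aa_cscalar_prod using c by simp
  have "cis (of_int r * \<theta>) = cis \<theta>" "cis (of_int r * \<phi>) = cis (- \<phi>)"
    using has_angle_order_cis_eq_iff[OF order(1), of r 1]
      has_angle_order_cis_eq_iff[OF order(2), of r "- 1"] r by simp_all
  then have "cis (of_int r * (\<theta> - \<phi>)) = cis (\<theta> + \<phi>)" "cis (of_int r * (\<theta> + \<phi>)) = cis (\<theta> - \<phi>)"
    by (simp_all add: right_diff_distrib distrib_left cis_divide cis_mult
        flip: cis_mult[of "of_int r * \<theta>"] cis_divide[of "of_int r * \<theta>"])
  then have "cos (of_int r * (\<theta> - \<phi>)) = cos (\<theta> + \<phi>)" "cos (of_int r * (\<theta> + \<phi>)) = cos (\<theta> - \<phi>)"
    by (metis cis.sel(1))+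
  then have bb: "?Y i \<bullet>c ?Y (i - r) = 0"
    unfolding rotation_orbit_bb_cscalar_prod using c by simp
  have ab: "?X j \<bullet>c ?Y k = 0" if "p dvd j - k \<or> q dvd j - k + 1" for j k
    unfolding rotation_orbit_ab_cscalar_prod
    using that has_angle_order_sin_eq_0 order by (metis mult_zero_left mult_zero_right)
  have "?X i \<bullet>c ?Y i = 0" "?X i \<bullet>c ?Y (i - r) = 0"
    "?X (i - 1) \<bullet>c ?Y i = 0" "?X (i - 1) \<bullet>c ?Y (i - r) = 0"
    using r ab[of i i] ab[of i "i - r"] ab[of "i - 1" i] ab[of "i - 1" "i - r"]
    by (simp_all add: cong_iff_dvd_diff algebra_simps)
  with aa bb have "corthogonal [?X i, ?X (i - 1), ?Y i, ?Y (i - r)]"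
    using rotation_orbit_ab_nonzero[of \<theta> \<phi> c, symmetric]
    by (intro sorted_wrt_imp_corthogonal[where n = 4]) (simp_all add: rotation_orbit_ab_carrier)
  then show ?thesis
    using corthogonal_imp_orthogonal_basis[of "[?X i, ?X (i - 1), ?Y i, ?Y (i - r)]" 4]
    by (simp add: rotation_orbit_ab_carrier)
qed

lemma rotation_orbit_a_neq_rotation_orbit_b:
  fixes p q :: int
  assumes "has_angle_order \<theta> p" "has_angle_order \<phi> q" "odd p" "odd q" "coprime p q" "p * q > 0"
  shows "rotation_orbit \<theta> \<phi> (vec_a c \<phi>) i \<noteq> rotation_orbit \<theta> \<phi> (vec_b c) j"
proof
  define n where "n = nat (p * q)"
  have "odd n"
    using assms by (simp add: n_def even_nat_iff)
  have "cis \<phi> ^ n = cis (of_int (p * q * 1) * \<phi>)"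
    using cis_of_int_mult_power[of "p * q" 1 \<phi>] \<open>p * q > 0\<close> by (simp add: n_def)
  also have "\<dots> = 1"
    using \<open>has_angle_order \<phi> q\<close> by (simp add: has_angle_order_def del: of_int_mult)
  finally have root: "cis \<phi> ^ n = 1" .
  then have root_uminus: "cis (- \<phi>) ^ n = 1"
    by (simp add: power_inverse flip: cis_inverse)
  assume "rotation_orbit \<theta> \<phi> (vec_a c \<phi>) i = rotation_orbit \<theta> \<phi> (vec_b c) j"
  then have "cis (- \<phi>) ^ n = of_real c ^ n" "(- of_real c * cis \<phi>) ^ n = 1 ^ n"
    unfolding vec_a_eq vec_b_eq n_def using rotation_orbit_eq_imp_power_eq[OF assms] by blast+
  then have "(of_real c :: complex) ^ n = 1" "- ((of_real c :: complex) ^ n) = 1"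
    using root root_uminus \<open>odd n\<close> by (simp_all add: power_mult_distrib)
  then show False
    by simp
qed

lemma rotation_orbit_ab_eq_iff:
  fixes p q :: int
  assumes order: "has_angle_order \<theta> p" "has_angle_order \<phi> q"
    and pq: "odd p" "odd q" "coprime p q" "p * q > 0" and "c \<noteq> 0"
    and "v \<in> {vec_a c \<phi>, vec_b c}" "w \<in> {vec_a c \<phi>, vec_b c}"
  shows "rotation_orbit \<theta> \<phi> v i = rotation_orbit \<theta> \<phi> w j \<longleftrightarrow> v = w \<and> [i = j] (mod p * q)"
proof (cases "v = w")
  assume "v = w"
  obtain \<alpha> \<beta> where "v = vec_of_complex_pair \<alpha> \<beta>" "\<alpha> \<noteq> 0" "\<beta> \<noteq> 0"
    using assms(8) \<open>c \<noteq> 0\<close> by (auto simp: vec_a_eq vec_b_eq)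
  then show ?thesis
    using rotation_orbit_eq_iff[OF order pq(1-3)] \<open>v = w\<close> by simp
next
  assume "v \<noteq> w"
  then show ?thesis
    using assms(8,9) rotation_orbit_a_neq_rotation_orbit_b[OF order pq, of c]
      rotation_orbit_a_neq_rotation_orbit_b[OF order pq, of c, symmetric] by auto
qed

lemma rotation_orbits_ab_kochen_specker_pair:
  fixes p q r :: int
  assumes order: "has_angle_order \<theta> p" "has_angle_order \<phi> q"
    and pq: "odd p" "odd q" "coprime p q"
    and c: "c \<noteq> 0" "cos (\<theta> - \<phi>) + c\<^sup>2 * cos (\<theta> + \<phi>) = 0"
    and r: "0 < r" "r < p * q" "[r = 1] (mod p)" "[r = - 1] (mod q)"
  shows "kochen_specker_pair 4
    (rotation_orbit \<theta> \<phi> (vec_a c \<phi>) ` {0..<p * q} \<union> rotation_orbit \<theta> \<phi> (vec_b c) ` {0..<p * q})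
    (map (\<lambda>i. {rotation_orbit \<theta> \<phi> (vec_a c \<phi>) i, rotation_orbit \<theta> \<phi> (vec_a c \<phi>) (i - 1),
               rotation_orbit \<theta> \<phi> (vec_b c) i, rotation_orbit \<theta> \<phi> (vec_b c) (i - r)})
       [0..p * q - 1])"
proof -
  let ?a = "vec_a c \<phi>" and ?b = "vec_b c" and ?X = "rotation_orbit \<theta> \<phi>"
  have "p * q > 0"
    using r by simp
  define s where "s = (\<lambda>_. r)(?a := 1)"
  have "?a \<noteq> ?b"
    using rotation_orbit_a_neq_rotation_orbit_b[OF order pq \<open>p * q > 0\<close>] by metis
  then have quadruple: "(\<Union>v\<in>{?a, ?b}. {?X v i, ?X v (i - s v)}) =
      {?X ?a i, ?X ?a (i - 1), ?X ?b i, ?X ?b (i - r)}" for i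
    by (auto simp: s_def)
  have "kochen_specker_pair 4 (\<Union>v\<in>{?a, ?b}. ?X v ` {0..<p * q})
      (map (\<lambda>i. \<Union>v\<in>{?a, ?b}. {?X v i, ?X v (i - s v)}) [0..p * q - 1])"
  proof (rule kochen_specker_pair_cyclic_orbits)
    show "\<not> p * q dvd s v" for v
      using r by (auto simp: s_def zdvd_not_zless)
    show "?X v i = ?X w j \<longleftrightarrow> v = w \<and> [i = j] (mod p * q)"
      if "v \<in> {?a, ?b}" "w \<in> {?a, ?b}" for v w i j
      using rotation_orbit_ab_eq_iff[OF order pq \<open>p * q > 0\<close> c(1) that] .
    show "orthogonal_basis 4 (\<Union>v\<in>{?a, ?b}. {?X v i, ?X v (i - s v)})" for i
      unfolding quadruple
      using rotation_orbit_ab_quadruple_orthogonal_basis[OF order c(2) r(3,4)] .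
  qed (use pq \<open>p * q > 0\<close> in auto)
  then show ?thesis
    unfolding quadruple by simp
qed

theorem theorem1:
  fixes p q k\<^sub>p k\<^sub>q r :: int and c :: real and a b :: "real vec" and M :: "real mat"
    and B :: "int \<Rightarrow> real vec set" and V :: "real vec set"
  assumes "p \<ge> 3" and "q \<ge> 3" and "odd p" and "odd q" and "coprime p q"
    and "gcd k\<^sub>p p = 1" and "gcd k\<^sub>q q = 1"
    and "c \<noteq> 0"
    and "c\<^sup>2 = - (cos (2 * pi * (of_int k\<^sub>p / of_int p - of_int k\<^sub>q / of_int q))
               / cos (2 * pi * (of_int k\<^sub>p / of_int p + of_int k\<^sub>q / of_int q)))"
    and "a = vec_a c (2 * pi * of_int k\<^sub>q / of_int q)"
    and "b = vec_b c"
    and "r = (THE r. 0 < r \<and> r < p * q \<and> [r = 1] (mod p) \<and> [r = - 1] (mod q))"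
    and "M = kronecker_product (rotation_mat p k\<^sub>p) (rotation_mat q k\<^sub>q)"
    and "B = (\<lambda>i. {mat_int_pow 4 M i *\<^sub>v a, mat_int_pow 4 M (i - 1) *\<^sub>v a,
                   mat_int_pow 4 M i *\<^sub>v b, mat_int_pow 4 M (i - r) *\<^sub>v b})"
    and "V = {mat_int_pow 4 M i *\<^sub>v a | i. 0 \<le> i \<and> i < p * q}
           \<union> {mat_int_pow 4 M i *\<^sub>v b | i. 0 \<le> i \<and> i < p * q}"
  shows "(\<forall>i. 0 \<le> i \<and> i < p * q \<longrightarrow> orthogonal_basis 4 (B i)) \<and>
         kochen_specker_pair 4 V (map B [0..p * q - 1])"
proof -
  define \<theta> \<phi> where "\<theta> = 2 * pi * of_int k\<^sub>p / of_int p" and "\<phi> = 2 * pi * of_int k\<^sub>q / of_int q"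
  have order: "has_angle_order \<theta> p" "has_angle_order \<phi> q"
    using assms(1,2,6,7) by (simp_all add: \<theta>_def \<phi>_def has_angle_order_2pi_frac coprime_iff_gcd_eq_1)
  have r: "0 < r" "r < p * q" "[r = 1] (mod p)" "[r = - 1] (mod q)"
    using theI'[OF binary_chinese_remainder_unique_pos_int[of p q 1 "- 1"]] assms(1,2,5)
    by (simp_all add: assms(12))
  have c: "cos (\<theta> - \<phi>) + c\<^sup>2 * cos (\<theta> + \<phi>) = 0"
    \<comment> \<open>If \<open>cos (\<theta> + \<phi>) = 0\<close>, then the quotient is \<open>0\<close> by convention, contradicting \<open>c \<noteq> 0\<close>.\<close>
    using assms(8,9) by (cases "cos (\<theta> + \<phi>) = 0")
      (simp_all add: \<theta>_def \<phi>_def right_diff_distrib distrib_left)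
  have a: "a = vec_a c \<phi>"
    by (simp add: assms(10) \<phi>_def)
  have M: "mat_int_pow 4 M i *\<^sub>v v = rotation_orbit \<theta> \<phi> v i" for i v
    by (simp add: rotation_orbit_def rotation_kron_def plane_rotation_def
        assms(13) rotation_mat_def \<theta>_def \<phi>_def)
  have "V = rotation_orbit \<theta> \<phi> a ` {0..<p * q} \<union> rotation_orbit \<theta> \<phi> b ` {0..<p * q}"
    by (auto simp: assms(15) M)
  then have "kochen_specker_pair 4 V (map B [0..p * q - 1])"
    using rotation_orbits_ab_kochen_specker_pair[OF order assms(3-5,8) c r]
    by (simp add: assms(11,14) a M)
  moreover have "orthogonal_basis 4 (B i)" for i
    using rotation_orbit_ab_quadruple_orthogonal_basis[OF order c r(3,4)]
    by (simp add: assms(11,14) a M)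
  ultimately show ?thesis
    by blast
qed

end
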